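(* Let $M$ be a parallelizable smooth manifold of real dimension $2n$, $n\ge2$, with a global frame $\{v_1,\dots,v_n,w_1,\dots,w_n\}$ of $TM$ and dual coframe $\{v^1,\dots,v^n,w^1,\dots,w^n\}$. Let $J$ be the almost complex structure with $Jv_i=w_i$, $Jw_i=-v_i$ for all $i$, let $g=-\sum_{i=1}^n v^i\otimes v^i+\sum_{i=1}^n w^i\otimes w^i$, and let $\nabla^g$ be the Levi-Civita connection of $g$. For a $1$-form $\eta$ let $\nabla^g+J\otimes\eta$ denote the affine connection $(X,Y)\mapsto\nabla^g_XY+\eta(Y)JX$. Then the $2n$ pairs $(g,\bar\nabla^i)$ and $(g,\bar\nabla^{n+i})$, $1\le i\le n$, where $\bar\nabla^i=\nabla^g+J\otimes v^i$ and $\bar\nabla^{n+i}=\nabla^g+J\otimes w^i$, are quasi-statistical structures on $M$.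
   Context: Given a pseudo-Riemannian metric $g$ and an affine connection $\nabla$ on $M$ with torsion $T^\nabla$, the pair $(g,\nabla)$ is a quasi-statistical structure if $(\nabla_Xg)(Y,Z)-(\nabla_Yg)(X,Z)+g(T^\nabla(X,Y),Z)=0$ for all vector fields $X,Y,Z$. *)

theory Defs
  imports "HOL-Analysis.Analysis" "HOL-Library.Function_Algebras"
begin

text \<open>\<open>C\<^sup>k\<close> and smooth maps on an open subset of a Euclidean space, in terms of iterated directional
  derivatives.\<close>

primrec Ck_on :: "nat \<Rightarrow> 'e::euclidean_space set \<Rightarrow> ('e \<Rightarrow> 'f::real_normed_vector) \<Rightarrow> bool" where
  "Ck_on 0 S f \<longleftrightarrow> continuous_on S f"
| "Ck_on (Suc k) S f \<longleftrightarrow>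
     (\<forall>x\<in>S. f differentiable (at x)) \<and> (\<forall>u. Ck_on k S (\<lambda>x. frechet_derivative f (at x) u))"

definition smooth_on :: "'e::euclidean_space set \<Rightarrow> ('e \<Rightarrow> 'f::real_normed_vector) \<Rightarrow> bool" where
  "smooth_on S f \<longleftrightarrow> (\<forall>k. Ck_on k S f)"

text \<open>The underlying space of a manifold is a Hausdorff, second countable type \<open>'a\<close>; the smooth structure
  is given by an atlas, whose members are pairs of a chart domain and a coordinate map. The atlas need
  not be maximal.\<close>

type_synonym ('a, 'e) atlas = "('a set \<times> ('a \<Rightarrow> 'e)) set"

definition smooth_manifold ::
    "('a::{t2_space,second_countable_topology}, 'e::euclidean_space) atlas \<Rightarrow> bool" where
  "smooth_manifold A \<longleftrightarrow>
     (\<Union>(U, \<phi>)\<in>A. U) = UNIV \<and>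
     (\<forall>(U, \<phi>)\<in>A. open U \<and> open (\<phi> ` U) \<and> homeomorphism U (\<phi> ` U) \<phi> (inv_into U \<phi>)) \<and>
     (\<forall>(U, \<phi>)\<in>A. \<forall>(V, \<psi>)\<in>A. smooth_on (\<phi> ` (U \<inter> V)) (\<psi> \<circ> inv_into U \<phi>))"

definition smooth_fun :: "('a, 'e::euclidean_space) atlas \<Rightarrow> ('a \<Rightarrow> real) \<Rightarrow> bool" where
  "smooth_fun A f \<longleftrightarrow> (\<forall>(U, \<phi>)\<in>A. smooth_on (\<phi> ` U) (f \<circ> inv_into U \<phi>))"

text \<open>Tangent vectors at \<open>p\<close> are the derivations at \<open>p\<close> of the algebra of smooth functions. They are
  extended by 0 to non-smooth functions, so that equality of tangent vectors is equality of functions.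
  Sums, differences and products of functions are pointwise.\<close>

type_synonym 'a tvec = "('a \<Rightarrow> real) \<Rightarrow> real"

definition tscale :: "real \<Rightarrow> 'a tvec \<Rightarrow> 'a tvec" where
  "tscale c D = (\<lambda>f. c * D f)"

definition tangent_space :: "('a, 'e::euclidean_space) atlas \<Rightarrow> 'a \<Rightarrow> 'a tvec set" where
  "tangent_space A p =
     {D. (\<forall>f. \<not> smooth_fun A f \<longrightarrow> D f = 0) \<and>
         (\<forall>f h. smooth_fun A f \<longrightarrow> smooth_fun A h \<longrightarrow> D (f + h) = D f + D h) \<and>
         (\<forall>c f. smooth_fun A f \<longrightarrow> D (\<lambda>x. c * f x) = c * D f) \<and>
         (\<forall>f h. smooth_fun A f \<longrightarrow> smooth_fun A h \<longrightarrow> D (f * h) = D f * h p + f p * D h)}"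

definition tbasis :: "'a tvec set \<Rightarrow> 'i set \<Rightarrow> ('i \<Rightarrow> 'a tvec) \<Rightarrow> bool" where
  "tbasis V I e \<longleftrightarrow>
     finite I \<and> (\<forall>i\<in>I. e i \<in> V) \<and>
     (\<forall>c. (\<Sum>i\<in>I. tscale (c i) (e i)) = 0 \<longrightarrow> (\<forall>i\<in>I. c i = 0)) \<and>
     (\<forall>D\<in>V. \<exists>c. D = (\<Sum>i\<in>I. tscale (c i) (e i)))"

text \<open>Smoothness of vector fields, 1-forms and tensor fields is expressed by evaluation on smooth
  functions and smooth vector fields.\<close>

type_synonym 'a vfield = "'a \<Rightarrow> 'a tvec"
type_synonym 'a oneform = "'a \<Rightarrow> 'a tvec \<Rightarrow> real"
type_synonym 'a endo = "'a \<Rightarrow> 'a tvec \<Rightarrow> 'a tvec"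
type_synonym 'a form2 = "'a \<Rightarrow> 'a tvec \<Rightarrow> 'a tvec \<Rightarrow> real"

definition vapp :: "'a vfield \<Rightarrow> ('a \<Rightarrow> real) \<Rightarrow> 'a \<Rightarrow> real" where
  "vapp X f = (\<lambda>p. X p f)"

definition vscale :: "('a \<Rightarrow> real) \<Rightarrow> 'a vfield \<Rightarrow> 'a vfield" where
  "vscale f X = (\<lambda>p. tscale (f p) (X p))"

definition vector_fields :: "('a, 'e::euclidean_space) atlas \<Rightarrow> 'a vfield set" where
  "vector_fields A =
     {X. (\<forall>p. X p \<in> tangent_space A p) \<and> (\<forall>f. smooth_fun A f \<longrightarrow> smooth_fun A (vapp X f))}"

definition lie_bracket :: "'a vfield \<Rightarrow> 'a vfield \<Rightarrow> 'a vfield" where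
  "lie_bracket X Y = (\<lambda>p f. X p (vapp Y f) - Y p (vapp X f))"

definition linear_form_on :: "'a tvec set \<Rightarrow> ('a tvec \<Rightarrow> real) \<Rightarrow> bool" where
  "linear_form_on V \<omega> \<longleftrightarrow>
     (\<forall>D\<in>V. \<forall>E\<in>V. \<omega> (D + E) = \<omega> D + \<omega> E) \<and> (\<forall>c. \<forall>D\<in>V. \<omega> (tscale c D) = c * \<omega> D)"

definition one_form :: "('a, 'e::euclidean_space) atlas \<Rightarrow> 'a oneform \<Rightarrow> bool" where
  "one_form A \<eta> \<longleftrightarrow>
     (\<forall>p. linear_form_on (tangent_space A p) (\<eta> p)) \<and>
     (\<forall>X\<in>vector_fields A. smooth_fun A (\<lambda>p. \<eta> p (X p)))"

definition global_frame ::
    "('a, 'e::euclidean_space) atlas \<Rightarrow> 'i set \<Rightarrow> ('i \<Rightarrow> 'a vfield) \<Rightarrow> bool" where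
  "global_frame A I e \<longleftrightarrow>
     (\<forall>i\<in>I. e i \<in> vector_fields A) \<and> (\<forall>p. tbasis (tangent_space A p) I (\<lambda>i. e i p))"

definition dual_coframe ::
    "('a, 'e::euclidean_space) atlas \<Rightarrow> 'i set \<Rightarrow> ('i \<Rightarrow> 'a vfield) \<Rightarrow> ('i \<Rightarrow> 'a oneform) \<Rightarrow> bool" where
  "dual_coframe A I e \<theta> \<longleftrightarrow>
     (\<forall>i\<in>I. one_form A (\<theta> i)) \<and>
     (\<forall>i\<in>I. \<forall>j\<in>I. \<forall>p. \<theta> i p (e j p) = (if i = j then 1 else 0))"

definition almost_complex_structure :: "('a, 'e::euclidean_space) atlas \<Rightarrow> 'a endo \<Rightarrow> bool" where
  "almost_complex_structure A J \<longleftrightarrow>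
     (\<forall>p. (\<forall>D\<in>tangent_space A p. J p D \<in> tangent_space A p \<and> J p (J p D) = - D) \<and>
          (\<forall>D\<in>tangent_space A p. \<forall>E\<in>tangent_space A p. J p (D + E) = J p D + J p E) \<and>
          (\<forall>c. \<forall>D\<in>tangent_space A p. J p (tscale c D) = tscale c (J p D))) \<and>
     (\<forall>X\<in>vector_fields A. (\<lambda>p. J p (X p)) \<in> vector_fields A)"

text \<open>The last clause says that the signature is the same at all points (\<open>q\<close> is the number of
  minus signs).\<close>

definition pseudo_riemannian_metric :: "('a, 'e::euclidean_space) atlas \<Rightarrow> 'a form2 \<Rightarrow> bool" where
  "pseudo_riemannian_metric A g \<longleftrightarrow>
     (\<forall>p. \<forall>D\<in>tangent_space A p. linear_form_on (tangent_space A p) (g p D)) \<and>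
     (\<forall>p. \<forall>D\<in>tangent_space A p. \<forall>E\<in>tangent_space A p. g p D E = g p E D) \<and>
     (\<forall>X\<in>vector_fields A. \<forall>Y\<in>vector_fields A. smooth_fun A (\<lambda>p. g p (X p) (Y p))) \<and>
     (\<forall>p. \<forall>D\<in>tangent_space A p. (\<forall>E\<in>tangent_space A p. g p D E = 0) \<longrightarrow> D = 0) \<and>
     (\<exists>q. \<forall>p. \<exists>e. tbasis (tangent_space A p) {..<DIM('e)} e \<and>
        (\<forall>i<DIM('e). \<forall>j<DIM('e).
           g p (e i) (e j) = (if i \<noteq> j then 0 else if i < q then -1 else 1)))"

type_synonym 'a connection = "'a vfield \<Rightarrow> 'a vfield \<Rightarrow> 'a vfield"

definition affine_connection :: "('a, 'e::euclidean_space) atlas \<Rightarrow> 'a connection \<Rightarrow> bool" where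
  "affine_connection A nabla \<longleftrightarrow>
     (\<forall>X\<in>vector_fields A. \<forall>Y\<in>vector_fields A. nabla X Y \<in> vector_fields A) \<and>
     (\<forall>X\<in>vector_fields A. \<forall>Y\<in>vector_fields A. \<forall>Z\<in>vector_fields A.
        nabla (X + Y) Z = nabla X Z + nabla Y Z \<and> nabla X (Y + Z) = nabla X Y + nabla X Z) \<and>
     (\<forall>f. smooth_fun A f \<longrightarrow> (\<forall>X\<in>vector_fields A. \<forall>Y\<in>vector_fields A.
        nabla (vscale f X) Y = vscale f (nabla X Y) \<and>
        nabla X (vscale f Y) = vscale (vapp X f) Y + vscale f (nabla X Y)))"

definition torsion :: "'a connection \<Rightarrow> 'a vfield \<Rightarrow> 'a vfield \<Rightarrow> 'a vfield" where
  "torsion nabla X Y = nabla X Y - nabla Y X - lie_bracket X Y"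

definition cov_deriv_form2 ::
    "'a connection \<Rightarrow> 'a form2 \<Rightarrow> 'a vfield \<Rightarrow> 'a vfield \<Rightarrow> 'a vfield \<Rightarrow> 'a \<Rightarrow> real" where
  "cov_deriv_form2 nabla g X Y Z = (\<lambda>p.
     X p (\<lambda>q. g q (Y q) (Z q)) - g p (nabla X Y p) (Z p) - g p (Y p) (nabla X Z p))"

definition levi_civita_connection ::
    "('a, 'e::euclidean_space) atlas \<Rightarrow> 'a form2 \<Rightarrow> 'a connection \<Rightarrow> bool" where
  "levi_civita_connection A g nabla \<longleftrightarrow>
     affine_connection A nabla \<and>
     (\<forall>X\<in>vector_fields A. \<forall>Y\<in>vector_fields A. torsion nabla X Y = 0) \<and>
     (\<forall>X\<in>vector_fields A. \<forall>Y\<in>vector_fields A. \<forall>Z\<in>vector_fields A. cov_deriv_form2 nabla g X Y Z = 0)"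

definition quasi_statistical ::
    "('a, 'e::euclidean_space) atlas \<Rightarrow> 'a form2 \<Rightarrow> 'a connection \<Rightarrow> bool" where
  "quasi_statistical A g nabla \<longleftrightarrow>
     pseudo_riemannian_metric A g \<and> affine_connection A nabla \<and>
     (\<forall>X\<in>vector_fields A. \<forall>Y\<in>vector_fields A. \<forall>Z\<in>vector_fields A. \<forall>p.
        cov_deriv_form2 nabla g X Y Z p - cov_deriv_form2 nabla g Y X Z p + g p (torsion nabla X Y p) (Z p) = 0)"

definition conn_plus :: "'a connection \<Rightarrow> 'a endo \<Rightarrow> 'a oneform \<Rightarrow> 'a connection" where
  "conn_plus nabla J \<eta> = (\<lambda>X Y p. nabla X Y p + tscale (\<eta> p (Y p)) (J p (X p)))"

end

theory Submission
  imports Defs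
begin

text \<open>
  The point is that \<open>J\<close> is self-adjoint for \<open>g\<close>: the coframe satisfies \<open>v\<^sup>i \<circ> J = - w\<^sup>i\<close> and
  \<open>w\<^sup>i \<circ> J = v\<^sup>i\<close>, so \<open>g(JX, Y) = g(X, JY)\<close>. For a torsion-free metric connection \<open>\<nabla>\<close> and
  \<open>\<nabla>' = \<nabla> + J \<otimes> \<eta>\<close> one has
  \<open>(\<nabla>'\<^sub>X g)(Y, Z) = - \<eta>(Y) g(JX, Z) - \<eta>(Z) g(Y, JX)\<close>. On antisymmetrising in \<open>X\<close> and \<open>Y\<close>,
  self-adjointness kills the \<open>\<eta>(Z)\<close> terms, and the remaining ones cancel against the torsion
  \<open>\<eta>(Y) JX - \<eta>(X) JY\<close>. Hence every 1-form \<open>\<eta>\<close> gives a quasi-statistical structure.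
\<close>

section \<open>Smooth functions\<close>

text \<open>A derivative at a point depends only on nearby values, so on an open set agreement
  passes to all iterated directional derivatives. This is needed because the sum and product rules
  are only available at points of \<open>S\<close>.\<close>

lemma Ck_on_cong:
  assumes "open S" "\<And>x. x \<in> S \<Longrightarrow> f x = h x" "Ck_on k S f"
  shows "Ck_on k S h"
  using assms(2,3)
proof (induction k arbitrary: f h)
  case 0
  then show ?case by (simp cong: continuous_on_cong)
next
  case (Suc k)
  have diff: "f differentiable (at x)" if "x \<in> S" for x using Suc.prems that by simp
  have "h differentiable (at x)" if "x \<in> S" for x
    using diff[OF that] Suc.prems(1) \<open>open S\<close> that unfolding differentiable_def
    by (blast intro: has_derivative_transform_within_open)
  moreover have "Ck_on k S (\<lambda>x. frechet_derivative h (at x) u)" for u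
  proof (rule Suc.IH)
    show "Ck_on k S (\<lambda>x. frechet_derivative f (at x) u)" using Suc.prems by simp
    show "frechet_derivative f (at x) u = frechet_derivative h (at x) u" if "x \<in> S" for x
      using frechet_derivative_transform_within_open[OF diff[OF that] \<open>open S\<close> that Suc.prems(1)]
      by simp
  qed
  ultimately show ?case by simp
qed

text \<open>The product rule mixes derivatives with undifferentiated factors; this lowers the order
  of the latter to match.\<close>

lemma Ck_on_Suc_imp_Ck_on: "Ck_on (Suc k) S f \<Longrightarrow> Ck_on k S f"
proof (induction k arbitrary: f)
  case 0
  then show ?case
    by (auto intro!: differentiable_imp_continuous_on differentiable_at_imp_differentiable_on)
next
  case (Suc k)
  have "Ck_on k S (\<lambda>x. frechet_derivative f (at x) u)" for u
  proof (rule Suc.IH)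
    show "Ck_on (Suc k) S (\<lambda>x. frechet_derivative f (at x) u)"
      \<comment> \<open>Only the outer \<open>Suc\<close> is unfolded, so the directional derivative
        keeps the form \<open>Ck_on (Suc k)\<close> that is required here.\<close>
      using Suc.prems by (simp only: Ck_on.simps(2)[of "Suc k" S f])
  qed
  then show ?case using Suc.prems by simp
qed

lemma Ck_on_const: "Ck_on k S (\<lambda>x. c)"
  by (induction k arbitrary: c) auto

lemma Ck_on_add:
  assumes "open S" "Ck_on k S f" "Ck_on k S h"
  shows "Ck_on k S (\<lambda>x. f x + h x)"
  using assms(2,3)
proof (induction k arbitrary: f h)
  case 0
  then show ?case by (simp add: continuous_on_add)
next
  case (Suc k)
  have fr: "frechet_derivative (\<lambda>x. f x + h x) (at x) =
      (\<lambda>u. frechet_derivative f (at x) u + frechet_derivative h (at x) u)" if "x \<in> S" for x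
    using Suc.prems that
    by (intro frechet_derivative_at[symmetric] has_derivative_add)
       (auto simp: frechet_derivative_works[symmetric])
  have "Ck_on k S (\<lambda>x. frechet_derivative (\<lambda>x. f x + h x) (at x) u)" for u
    by (rule Ck_on_cong[OF \<open>open S\<close> _ Suc.IH[of "\<lambda>x. frechet_derivative f (at x) u"
          "\<lambda>x. frechet_derivative h (at x) u"]]) (use Suc.prems fr in simp_all)
  then show ?case using Suc.prems by simp
qed

text \<open>The directional derivative of a product is a sum of two products, to which the induction
  hypothesis and \<open>Ck_on_add\<close> apply.\<close>

lemma Ck_on_mult:
  fixes f h :: "'e::euclidean_space \<Rightarrow> 'f::real_normed_algebra"
  assumes "open S" "Ck_on k S f" "Ck_on k S h"
  shows "Ck_on k S (\<lambda>x. f x * h x)"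
  using assms(2,3)
proof (induction k arbitrary: f h)
  case 0
  then show ?case by (simp add: continuous_on_mult)
next
  case (Suc k)
  have fr: "frechet_derivative (\<lambda>x. f x * h x) (at x) =
      (\<lambda>u. f x * frechet_derivative h (at x) u + frechet_derivative f (at x) u * h x)"
    if "x \<in> S" for x
    using Suc.prems that
    by (intro frechet_derivative_at[symmetric] has_derivative_mult)
       (auto simp: frechet_derivative_works[symmetric])
  have "Ck_on k S f" "Ck_on k S h" using Suc.prems Ck_on_Suc_imp_Ck_on by blast+
  then have "Ck_on k S (\<lambda>x. f x * frechet_derivative h (at x) u + frechet_derivative f (at x) u * h x)"
    for u using Suc.prems by (intro Ck_on_add \<open>open S\<close> Suc.IH) auto
  then have "Ck_on k S (\<lambda>x. frechet_derivative (\<lambda>x. f x * h x) (at x) u)" for u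
    by (rule Ck_on_cong[OF \<open>open S\<close>, rotated]) (use fr in simp)
  then show ?case using Suc.prems by simp
qed

lemma smooth_fun_const: "smooth_fun A (\<lambda>p. c)"
  by (auto simp: smooth_fun_def smooth_on_def o_def Ck_on_const)

lemma
  assumes "smooth_manifold A" "smooth_fun A f" "smooth_fun A h"
  shows smooth_fun_add: "smooth_fun A (\<lambda>p. f p + h p)"
    and smooth_fun_mult: "smooth_fun A (\<lambda>p. f p * h p)"
proof -
  have "open (\<phi> ` U)" if "(U, \<phi>) \<in> A" for U \<phi>
    using assms(1) that unfolding smooth_manifold_def by blast
  then show "smooth_fun A (\<lambda>p. f p + h p)" "smooth_fun A (\<lambda>p. f p * h p)"
    using assms(2,3) by (auto simp: smooth_fun_def smooth_on_def o_def intro!: Ck_on_add Ck_on_mult)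
qed

lemma smooth_fun_minus:
  assumes "smooth_manifold A" "smooth_fun A f"
  shows "smooth_fun A (\<lambda>p. - f p)"
  using smooth_fun_mult[OF assms(1) smooth_fun_const[of A "-1"] assms(2)] by simp

lemma smooth_fun_sum:
  assumes "smooth_manifold A" "\<And>i. i \<in> I \<Longrightarrow> smooth_fun A (f i)"
  shows "smooth_fun A (\<lambda>p. \<Sum>i\<in>I. f i p)"
  using assms(2)
  by (induction I rule: infinite_finite_induct) (auto simp: smooth_fun_const smooth_fun_add[OF assms(1)])

section \<open>Tangent vectors and vector fields\<close>

lemma tangent_space_zero: "0 \<in> tangent_space A p"
  by (simp add: tangent_space_def)

lemma tangent_space_add:
  "D \<in> tangent_space A p \<Longrightarrow> E \<in> tangent_space A p \<Longrightarrow> D + E \<in> tangent_space A p"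
  by (simp add: tangent_space_def algebra_simps)

lemma tangent_space_tscale: "D \<in> tangent_space A p \<Longrightarrow> tscale c D \<in> tangent_space A p"
  by (simp add: tangent_space_def tscale_def algebra_simps)

lemma tangent_space_uminus: "D \<in> tangent_space A p \<Longrightarrow> - D \<in> tangent_space A p"
  by (simp add: tangent_space_def)

lemma tangent_space_diff:
  "D \<in> tangent_space A p \<Longrightarrow> E \<in> tangent_space A p \<Longrightarrow> D - E \<in> tangent_space A p"
  using tangent_space_add[OF _ tangent_space_uminus, of D A p E] by simp

lemma tangent_space_sum:
  "(\<And>i. i \<in> I \<Longrightarrow> D i \<in> tangent_space A p) \<Longrightarrow> (\<Sum>i\<in>I. D i) \<in> tangent_space A p"
  by (induction I rule: infinite_finite_induct) (auto simp: tangent_space_zero intro: tangent_space_add)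

lemma vector_fields_tangent: "X \<in> vector_fields A \<Longrightarrow> X p \<in> tangent_space A p"
  by (simp add: vector_fields_def)

lemma vector_fields_add:
  assumes "smooth_manifold A" "X \<in> vector_fields A" "Y \<in> vector_fields A"
  shows "X + Y \<in> vector_fields A"
  using assms by (auto simp: vector_fields_def vapp_def tangent_space_add smooth_fun_add)

lemma vector_fields_vscale:
  assumes "smooth_manifold A" "smooth_fun A f" "X \<in> vector_fields A"
  shows "vscale f X \<in> vector_fields A"
proof -
  have "vapp (vscale f X) h = (\<lambda>p. f p * vapp X h p)" for h
    by (simp add: vapp_def vscale_def tscale_def)
  then show ?thesis
    using assms by (auto simp: vector_fields_def vscale_def[of f X] tangent_space_tscale smooth_fun_mult)
qed

section \<open>Linear forms and bases of a tangent space\<close>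

lemma linear_form_on_add: "linear_form_on V \<omega> \<Longrightarrow> D \<in> V \<Longrightarrow> E \<in> V \<Longrightarrow> \<omega> (D + E) = \<omega> D + \<omega> E"
  by (simp add: linear_form_on_def)

lemma linear_form_on_tscale: "linear_form_on V \<omega> \<Longrightarrow> D \<in> V \<Longrightarrow> \<omega> (tscale c D) = c * \<omega> D"
  by (simp add: linear_form_on_def)

lemma linear_form_on_uminus:
  assumes "linear_form_on V \<omega>" "D \<in> V"
  shows "\<omega> (- D) = - \<omega> D"
proof -
  have "- D = tscale (-1) D" by (auto simp: tscale_def)
  then show ?thesis using linear_form_on_tscale[OF assms, of "-1"] by simp
qed

lemma linear_form_on_diff:
  assumes "linear_form_on (tangent_space A p) \<omega>" "D \<in> tangent_space A p" "E \<in> tangent_space A p"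
  shows "\<omega> (D - E) = \<omega> D - \<omega> E"
  using linear_form_on_add[OF assms(1,2) tangent_space_uminus[OF assms(3)]]
    linear_form_on_uminus[OF assms(1,3)] by simp

lemma linear_form_on_zero:
  assumes "linear_form_on (tangent_space A p) \<omega>"
  shows "\<omega> 0 = 0"
  using linear_form_on_add[OF assms tangent_space_zero tangent_space_zero] by simp

lemma linear_form_on_sum:
  assumes "linear_form_on (tangent_space A p) \<omega>" "\<And>i. i \<in> I \<Longrightarrow> D i \<in> tangent_space A p"
  shows "\<omega> (\<Sum>i\<in>I. D i) = (\<Sum>i\<in>I. \<omega> (D i))"
  using assms(2)
  \<comment> \<open>Over an infinite \<open>I\<close> both sums are 0 by convention, a case settled
    by \<open>linear_form_on_zero\<close>.\<close>
  by (induction I rule: infinite_finite_induct)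
     (auto simp: linear_form_on_zero[OF assms(1)] linear_form_on_add[OF assms(1)] tangent_space_sum)

text \<open>Expanding \<open>D\<close> in the basis turns both values into the same combination.
  This reduces identities between coframe forms composed with \<open>J\<close> to checks on the
  frame.\<close>

lemma linear_form_on_eqI_basis:
  assumes "tbasis (tangent_space A p) I e"
    and "linear_form_on (tangent_space A p) \<omega>" "linear_form_on (tangent_space A p) \<omega>'"
    and "\<And>i. i \<in> I \<Longrightarrow> \<omega> (e i) = \<omega>' (e i)" and "D \<in> tangent_space A p"
  shows "\<omega> D = \<omega>' D"
proof -
  obtain c where c: "D = (\<Sum>i\<in>I. tscale (c i) (e i))" using assms(1,5) unfolding tbasis_def by blast
  have e: "e i \<in> tangent_space A p" if "i \<in> I" for i using assms(1) that unfolding tbasis_def by blast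
  have "\<omega> D = (\<Sum>i\<in>I. c i * \<omega> (e i))" unfolding c using e
    by (subst linear_form_on_sum[OF assms(2)])
       (auto simp: tangent_space_tscale linear_form_on_tscale[OF assms(2)])
  also have "\<dots> = (\<Sum>i\<in>I. c i * \<omega>' (e i))" using assms(4) by simp
  also have "\<dots> = \<omega>' D" unfolding c using e
    by (subst linear_form_on_sum[OF assms(3)])
       (auto simp: tangent_space_tscale linear_form_on_tscale[OF assms(3)])
  finally show ?thesis .
qed

text \<open>Applying \<open>\<theta> i\<close> to any expansion of \<open>D\<close> extracts its
  i-th coefficient. Nondegeneracy of the metric will follow: a vector killed by the whole coframe is
  0.\<close>

lemma tbasis_dual_expansion:
  assumes "tbasis (tangent_space A p) I e"
    and "\<And>i. i \<in> I \<Longrightarrow> linear_form_on (tangent_space A p) (\<theta> i)"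
    and "\<And>i j. i \<in> I \<Longrightarrow> j \<in> I \<Longrightarrow> \<theta> i (e j) = (if i = j then 1 else 0)"
    and "D \<in> tangent_space A p"
  shows "D = (\<Sum>i\<in>I. tscale (\<theta> i D) (e i))"
proof -
  obtain c where c: "D = (\<Sum>i\<in>I. tscale (c i) (e i))" using assms(1,4) unfolding tbasis_def by blast
  have e: "e i \<in> tangent_space A p" if "i \<in> I" for i using assms(1) that unfolding tbasis_def by blast
  have fin: "finite I" using assms(1) unfolding tbasis_def by blast
  have "\<theta> i D = c i" if i: "i \<in> I" for i
  proof -
    have "\<theta> i D = (\<Sum>j\<in>I. c j * \<theta> i (e j))" unfolding c using e
      by (subst linear_form_on_sum[OF assms(2)[OF i]])
         (auto simp: tangent_space_tscale linear_form_on_tscale[OF assms(2)[OF i]])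
    also have "\<dots> = (\<Sum>j\<in>I. if i = j then c j else 0)"
      using assms(3) i by (intro sum.cong) auto
    finally show ?thesis using i fin by simp
  qed
  then show ?thesis using c by simp
qed

text \<open>The frame is indexed by a disjoint sum, whereas the signature clause of a metric asks
  for indices below the dimension.\<close>

lemma tbasis_reindex:
  assumes "bij_betw f K I" "tbasis V I e"
  shows "tbasis V K (e \<circ> f)"
  unfolding tbasis_def
proof (intro conjI allI impI ballI)
  show "finite K" using assms unfolding tbasis_def by (simp add: bij_betw_finite)
  show "(e \<circ> f) k \<in> V" if "k \<in> K" for k
    using assms that unfolding tbasis_def by (auto dest: bij_betwE)
next
  fix c k assume c: "(\<Sum>i\<in>K. tscale (c i) ((e \<circ> f) i)) = 0" and k: "k \<in> K"
  define d where "d = c \<circ> inv_into K f"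
  have d: "d (f i) = c i" if "i \<in> K" for i
    using that assms(1) by (simp add: d_def bij_betw_inv_into_left)
  have "(\<Sum>i\<in>I. tscale (d i) (e i)) = (\<Sum>i\<in>K. tscale (d (f i)) (e (f i)))"
    using sum.reindex_bij_betw[OF assms(1), of "\<lambda>i. tscale (d i) (e i)"] by simp
  also have "\<dots> = 0" using c d by simp
  finally have "\<forall>i\<in>I. d i = 0" using assms(2) unfolding tbasis_def by blast
  then show "c k = 0" using d[OF k] bij_betwE[OF assms(1)] k by force
next
  fix D assume "D \<in> V"
  then obtain c where "D = (\<Sum>i\<in>I. tscale (c i) (e i))" using assms(2) unfolding tbasis_def by blast
  then have "D = (\<Sum>i\<in>K. tscale ((c \<circ> f) i) ((e \<circ> f) i))"
    using sum.reindex_bij_betw[OF assms(1), of "\<lambda>i. tscale (c i) (e i)"] by simp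
  then show "\<exists>c. D = (\<Sum>i\<in>K. tscale (c i) ((e \<circ> f) i))" by blast
qed

section \<open>Connections of the form \<open>\<nabla> + J \<otimes> \<eta>\<close>\<close>

text \<open>The added term J \<otimes> \<eta> is linear over smooth functions in both arguments, so
  it leaves the Leibniz rule intact.\<close>

lemma affine_connection_conn_plus:
  assumes "smooth_manifold A" "affine_connection A nabla" "almost_complex_structure A J" "one_form A \<eta>"
  shows "affine_connection A (conn_plus nabla J \<eta>)"
proof -
  note tangent = vector_fields_tangent
  have JV: "(\<lambda>p. J p (X p)) \<in> vector_fields A" if "X \<in> vector_fields A" for X
    using assms(3) that unfolding almost_complex_structure_def by blast
  have J_add: "J p (D + E) = J p D + J p E"
    if "D \<in> tangent_space A p" "E \<in> tangent_space A p" for p D E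
    using assms(3) that unfolding almost_complex_structure_def by blast
  have J_tscale: "J p (tscale c D) = tscale c (J p D)" if "D \<in> tangent_space A p" for p c D
    using assms(3) that unfolding almost_complex_structure_def by blast
  have lin: "linear_form_on (tangent_space A p) (\<eta> p)" for p
    using assms(4) unfolding one_form_def by blast
  have smooth: "smooth_fun A (\<lambda>p. \<eta> p (X p))" if "X \<in> vector_fields A" for X
    using assms(4) that unfolding one_form_def by blast
  \<comment> \<open>In this form closure of vector fields under sums and smooth multiples
    applies.\<close>
  have eq: "conn_plus nabla J \<eta> X Y = nabla X Y + vscale (\<lambda>p. \<eta> p (Y p)) (\<lambda>p. J p (X p))" for X Y
    by (auto simp: conn_plus_def vscale_def)
  show ?thesis
    unfolding affine_connection_def
  proof (intro conjI ballI allI impI)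
    fix X Y assume X: "X \<in> vector_fields A" and Y: "Y \<in> vector_fields A"
    have "nabla X Y \<in> vector_fields A" using assms(2) X Y unfolding affine_connection_def by blast
    then show "conn_plus nabla J \<eta> X Y \<in> vector_fields A"
      unfolding eq using X Y assms(1)
      by (intro vector_fields_add vector_fields_vscale smooth JV)
  next
    fix X Y Z assume X: "X \<in> vector_fields A" and Y: "Y \<in> vector_fields A" and Z: "Z \<in> vector_fields A"
    have "nabla (X + Y) Z = nabla X Z + nabla Y Z" "nabla X (Y + Z) = nabla X Y + nabla X Z"
      using assms(2) X Y Z unfolding affine_connection_def by blast+
    then show "conn_plus nabla J \<eta> (X + Y) Z = conn_plus nabla J \<eta> X Z + conn_plus nabla J \<eta> Y Z"
      and "conn_plus nabla J \<eta> X (Y + Z) = conn_plus nabla J \<eta> X Y + conn_plus nabla J \<eta> X Z"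
      using tangent[OF X] tangent[OF Y] tangent[OF Z]
      by (auto simp: fun_eq_iff conn_plus_def tscale_def J_add linear_form_on_add[OF lin] algebra_simps)
  next
    fix f X Y assume f: "smooth_fun A f" and X: "X \<in> vector_fields A" and Y: "Y \<in> vector_fields A"
    have "nabla (vscale f X) Y = vscale f (nabla X Y)"
      "nabla X (vscale f Y) = vscale (vapp X f) Y + vscale f (nabla X Y)"
      using assms(2) X Y f unfolding affine_connection_def by blast+
    then show "conn_plus nabla J \<eta> (vscale f X) Y = vscale f (conn_plus nabla J \<eta> X Y)"
      and "conn_plus nabla J \<eta> X (vscale f Y) = vscale (vapp X f) Y + vscale f (conn_plus nabla J \<eta> X Y)"
      using tangent[OF X] tangent[OF Y]
      \<comment> \<open>\<open>tscale\<close> stays folded until scalars have been pulled out of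
        \<open>J\<close> and \<open>\<eta>\<close>; the rest is arithmetic of reals.\<close>
      by (auto simp: fun_eq_iff conn_plus_def vscale_def J_tscale linear_form_on_tscale[OF lin])
         (auto simp: tscale_def algebra_simps)
  qed
qed

text \<open>The frame is replaced by the hypothesis \<open>self_adjoint\<close>, so one argument
  covers all 2n one-forms.\<close>

theorem quasi_statistical_conn_plus:
  assumes "smooth_manifold A" "pseudo_riemannian_metric A g" "levi_civita_connection A g nabla"
    and "almost_complex_structure A J" "one_form A \<eta>"
    and self_adjoint: "\<And>p D E. D \<in> tangent_space A p \<Longrightarrow> E \<in> tangent_space A p \<Longrightarrow>
      g p (J p D) E = g p D (J p E)"
  shows "quasi_statistical A g (conn_plus nabla J \<eta>)"
  unfolding quasi_statistical_def
proof (intro conjI ballI allI)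
  have conn: "affine_connection A nabla" using assms(3) by (simp add: levi_civita_connection_def)
  show "pseudo_riemannian_metric A g" using assms(2) .
  show "affine_connection A (conn_plus nabla J \<eta>)"
    by (rule affine_connection_conn_plus[OF assms(1) conn assms(4,5)])
  fix X Y Z p
  assume X: "X \<in> vector_fields A" and Y: "Y \<in> vector_fields A" and Z: "Z \<in> vector_fields A"
  have lin: "linear_form_on (tangent_space A p) (g p D)" if "D \<in> tangent_space A p" for D
    using assms(2) that by (simp add: pseudo_riemannian_metric_def)
  have sym: "g p D E = g p E D" if "D \<in> tangent_space A p" "E \<in> tangent_space A p" for D E
    using assms(2) that by (simp add: pseudo_riemannian_metric_def)
  have JT: "J p D \<in> tangent_space A p" if "D \<in> tangent_space A p" for D
    using assms(4) that unfolding almost_complex_structure_def by blast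
  have nablaT: "nabla V W p \<in> tangent_space A p" if "V \<in> vector_fields A" "W \<in> vector_fields A" for V W
    using conn that unfolding affine_connection_def by (blast intro: vector_fields_tangent)
  \<comment> \<open>Since \<open>nabla\<close> is metric, only the contributions of J \<otimes>
    \<eta> survive.\<close>
  have cov: "cov_deriv_form2 (conn_plus nabla J \<eta>) g U V W p =
      - \<eta> p (V p) * g p (J p (U p)) (W p) - \<eta> p (W p) * g p (V p) (J p (U p))"
    if U: "U \<in> vector_fields A" and V: "V \<in> vector_fields A" and W: "W \<in> vector_fields A" for U V W
  proof -
    have T: "U p \<in> tangent_space A p" "V p \<in> tangent_space A p" "W p \<in> tangent_space A p"
      using U V W by (auto intro: vector_fields_tangent)
    have split: "g p D (nabla U E p + tscale c (J p (U p))) = g p D (nabla U E p) + c * g p D (J p (U p))"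
      if "D \<in> tangent_space A p" "E \<in> vector_fields A" for D E c
      using that U T
      by (simp add: linear_form_on_add[OF lin] linear_form_on_tscale[OF lin] nablaT JT tangent_space_tscale)
    have "cov_deriv_form2 nabla g U V W p = 0"
      using assms(3) U V W unfolding levi_civita_connection_def by simp
    \<comment> \<open>The metric is defined as linear in its second slot; symmetry carries
      \<open>split\<close> over to the first.\<close>
    moreover have "g p (nabla U V p + tscale c (J p (U p))) (W p) =
        g p (nabla U V p) (W p) + c * g p (J p (U p)) (W p)" for c
      using split[of "W p" V c] T U V
      by (simp add: sym[of _ "W p"] nablaT JT tangent_space_tscale tangent_space_add)
    ultimately show ?thesis
      using split[OF T(2) W] by (simp add: cov_deriv_form2_def conn_plus_def)
  qed
  have T: "X p \<in> tangent_space A p" "Y p \<in> tangent_space A p" "Z p \<in> tangent_space A p"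
    using X Y Z by (auto intro: vector_fields_tangent)
  \<comment> \<open>The Lie bracket cancels against the \<open>nabla\<close> terms, leaving the
    antisymmetrisation of J \<otimes> \<eta>.\<close>
  have "torsion nabla X Y = 0"
    using assms(3) X Y unfolding levi_civita_connection_def by blast
  then have "torsion nabla X Y p = 0" by simp
  then have tor: "torsion (conn_plus nabla J \<eta>) X Y p =
      tscale (\<eta> p (Y p)) (J p (X p)) - tscale (\<eta> p (X p)) (J p (Y p))"
    by (simp add: torsion_def conn_plus_def algebra_simps)
  have "g p (torsion (conn_plus nabla J \<eta>) X Y p) (Z p) =
      \<eta> p (Y p) * g p (J p (X p)) (Z p) - \<eta> p (X p) * g p (J p (Y p)) (Z p)"
    unfolding tor using T
    by (simp add: sym[of _ "Z p"] JT tangent_space_tscale tangent_space_diff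
        linear_form_on_diff[OF lin] linear_form_on_tscale[OF lin])
  \<comment> \<open>The coefficient of \<eta>(Z) is thus symmetric in X and Y and drops out of the
    difference.\<close>
  moreover have "g p (Y p) (J p (X p)) = g p (X p) (J p (Y p))"
    using T by (metis JT self_adjoint sym)
  ultimately show "cov_deriv_form2 (conn_plus nabla J \<eta>) g X Y Z p -
      cov_deriv_form2 (conn_plus nabla J \<eta>) g Y X Z p +
      g p (torsion (conn_plus nabla J \<eta>) X Y p) (Z p) = 0"
    using X Y Z by (simp add: cov)
qed

section \<open>The neutral metric of a frame\<close>

text \<open>Duality over the disjoint sum splits into four blocks; the mixed ones vanish because
  \<open>Inl\<close> and \<open>Inr\<close> indices never coincide.\<close>

lemma dual_coframe_Plus:
  "dual_coframe A (I <+> K) (case_sum v w) (case_sum v' w') \<longleftrightarrow>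
     (\<forall>i\<in>I. one_form A (v' i)) \<and> (\<forall>k\<in>K. one_form A (w' k)) \<and>
     (\<forall>i\<in>I. \<forall>j\<in>I. \<forall>p. v' i p (v j p) = (if i = j then 1 else 0)) \<and>
     (\<forall>i\<in>I. \<forall>k\<in>K. \<forall>p. v' i p (w k p) = 0) \<and>
     (\<forall>k\<in>K. \<forall>i\<in>I. \<forall>p. w' k p (v i p) = 0) \<and>
     (\<forall>k\<in>K. \<forall>l\<in>K. \<forall>p. w' k p (w l p) = (if k = l then 1 else 0))"
proof -
  have "(\<forall>x\<in>I <+> K. P x) \<longleftrightarrow> (\<forall>i\<in>I. P (Inl i)) \<and> (\<forall>k\<in>K. P (Inr k))" for P
    by auto
  then show ?thesis by (auto simp: dual_coframe_def)
qed

text \<open>At every point the frame is orthonormal up to sign, with n minus signs. This fixes the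
  signature, and pairing with the frame recovers the coframe, which gives nondegeneracy.\<close>

lemma pseudo_riemannian_metric_of_coframe:
  fixes A :: "('a::{t2_space,second_countable_topology}, 'e::euclidean_space) atlas"
  assumes mfd: "smooth_manifold A" and dim: "DIM('e) = 2 * n"
    and frame: "global_frame A ({1..n} <+> {1..n}) (case_sum v w)"
    and dual: "dual_coframe A ({1..n} <+> {1..n}) (case_sum v w) (case_sum v' w')"
    and g: "g = (\<lambda>p D E. - (\<Sum>i=1..n. v' i p D * v' i p E) + (\<Sum>i=1..n. w' i p D * w' i p E))"
  shows "pseudo_riemannian_metric A g"
proof -
  have forms: "one_form A (v' i)" "one_form A (w' i)" if "i \<in> {1..n}" for i
    using dual that by (auto simp: dual_coframe_Plus)
  have vw: "v' i p (v j p) = (if i = j then 1 else 0)" "v' i p (w j p) = 0"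
    "w' i p (w j p) = (if i = j then 1 else 0)" "w' i p (v j p) = 0"
    if "i \<in> {1..n}" "j \<in> {1..n}" for i j p
    using dual that by (auto simp: dual_coframe_Plus)
  have lin: "linear_form_on (tangent_space A p) (v' i p)" "linear_form_on (tangent_space A p) (w' i p)"
    if "i \<in> {1..n}" for i p
    using forms[OF that] unfolding one_form_def by blast+
  have smooth: "smooth_fun A (\<lambda>p. v' i p (X p))" "smooth_fun A (\<lambda>p. w' i p (X p))"
    if "i \<in> {1..n}" "X \<in> vector_fields A" for i X
    using forms[OF that(1)] that(2) unfolding one_form_def by blast+
  have basis: "tbasis (tangent_space A p) ({1..n} <+> {1..n}) (\<lambda>i. case_sum v w i p)" for p
    using frame unfolding global_frame_def by blast
  have T: "v i p \<in> tangent_space A p" "w i p \<in> tangent_space A p" if "i \<in> {1..n}" for i p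
    using basis[of p] that unfolding tbasis_def by force+
  have gv: "g p D (v j p) = - v' j p D" and gw: "g p D (w j p) = w' j p D" if j: "j \<in> {1..n}" for p D j
  proof -
    have "(\<Sum>i=1..n. v' i p D * v' i p (v j p)) = (\<Sum>i=1..n. if i = j then v' i p D else 0)"
      "(\<Sum>i=1..n. w' i p D * w' i p (w j p)) = (\<Sum>i=1..n. if i = j then w' i p D else 0)"
      using j by (intro sum.cong refl, simp add: vw)+
    then show "g p D (v j p) = - v' j p D" "g p D (w j p) = w' j p D"
      using j by (simp_all add: g vw(2,4))
  qed
  show ?thesis
    unfolding pseudo_riemannian_metric_def
  proof (intro conjI allI ballI impI)
    fix p D assume "D \<in> tangent_space A p"
    show "linear_form_on (tangent_space A p) (g p D)"
      unfolding linear_form_on_def g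
      using linear_form_on_add[OF lin(1)] linear_form_on_add[OF lin(2)]
        linear_form_on_tscale[OF lin(1)] linear_form_on_tscale[OF lin(2)]
      by (auto simp: algebra_simps sum.distrib sum_distrib_left)
  next
    show "g p D E = g p E D" for p D E by (simp add: g mult.commute)
  next
    fix X Y assume "X \<in> vector_fields A" "Y \<in> vector_fields A"
    then show "smooth_fun A (\<lambda>p. g p (X p) (Y p))"
      unfolding g
      by (intro smooth_fun_add smooth_fun_minus smooth_fun_sum smooth_fun_mult mfd smooth)
  next
    fix p D assume D: "D \<in> tangent_space A p" and 0: "\<forall>E\<in>tangent_space A p. g p D E = 0"
    \<comment> \<open>The coframe values are, up to sign, the pairings of \<open>D\<close> with the
      frame vectors.\<close>
    have zero: "v' i p D = 0" "w' i p D = 0" if "i \<in> {1..n}" for i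
      using 0 T[OF that] gv[OF that] gw[OF that] by force+
    have "D = (\<Sum>i\<in>{1..n} <+> {1..n}. tscale (case_sum v' w' i p D) (case_sum v w i p))"
      by (rule tbasis_dual_expansion[OF basis _ _ D])
         (use dual in \<open>auto simp: dual_coframe_def one_form_def\<close>)
    also have "\<dots> = 0"
      by (rule sum.neutral) (auto simp: zero tscale_def)
    finally show "D = 0" .
  next
    \<comment> \<open>\<open>f\<close> lists the v-vectors first, since the signature clause puts
      the negative directions first, and shifts from indices starting at 0 to indices starting at
      1.\<close>
    define f :: "nat \<Rightarrow> nat + nat" where "f k = (if k < n then Inl (k + 1) else Inr (k - n + 1))" for k
    have bij: "bij_betw f {..<DIM('e)} ({1..n} <+> {1..n})"
      unfolding dim
      \<comment> \<open>Truncated subtraction is harmless here, as frame indices are at least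
        1.\<close>
      by (rule bij_betw_byWitness[where f' = "case_sum (\<lambda>i. i - 1) (\<lambda>i. n + i - 1)"])
         (auto simp: f_def)
    have "tbasis (tangent_space A p) {..<DIM('e)} ((\<lambda>i. case_sum v w i p) \<circ> f)" for p
      by (rule tbasis_reindex[OF bij basis])
    moreover have "g p (case_sum v w (f i) p) (case_sum v w (f j) p) =
        (if i \<noteq> j then 0 else if i < n then -1 else 1)" if "i < DIM('e)" "j < DIM('e)" for i j p
      using that unfolding dim f_def by (auto simp: gv gw vw)
    \<comment> \<open>The witness is q = n, the number of v-vectors, at all points alike.\<close>
    ultimately show "\<exists>q. \<forall>p. \<exists>e. tbasis (tangent_space A p) {..<DIM('e)} e \<and>
        (\<forall>i<DIM('e). \<forall>j<DIM('e).
           g p (e i) (e j) = (if i \<noteq> j then 0 else if i < q then -1 else 1))"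
      by (intro exI[of _ n] allI) (auto intro!: exI)
  qed
qed

section \<open>Self-adjointness of \<open>J\<close> for the frame metric\<close>

theorem corollary6p5:
  fixes A :: "('a::{t2_space,second_countable_topology}, 'e::euclidean_space) atlas"
    and n :: nat
    and v w :: "nat \<Rightarrow> 'a vfield"
    and v' w' :: "nat \<Rightarrow> 'a oneform"
    and J :: "'a endo"
    and g :: "'a form2"
    and nabla :: "'a connection"
  assumes "smooth_manifold A" and "DIM('e) = 2 * n" and "n \<ge> 2"
    and "global_frame A ({1..n} <+> {1..n}) (case_sum v w)"
    and "dual_coframe A ({1..n} <+> {1..n}) (case_sum v w) (case_sum v' w')"
    and "almost_complex_structure A J"
    and "\<And>i p. i \<in> {1..n} \<Longrightarrow> J p (v i p) = w i p"
    and "\<And>i p. i \<in> {1..n} \<Longrightarrow> J p (w i p) = - v i p"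
    and "g = (\<lambda>p D E. - (\<Sum>i=1..n. v' i p D * v' i p E) + (\<Sum>i=1..n. w' i p D * w' i p E))"
    and "levi_civita_connection A g nabla"
  shows "\<forall>i\<in>{1..n}. quasi_statistical A g (conn_plus nabla J (v' i)) \<and>
                    quasi_statistical A g (conn_plus nabla J (w' i))"
proof -
  have metric: "pseudo_riemannian_metric A g"
    by (rule pseudo_riemannian_metric_of_coframe[OF assms(1,2,4,5,9)])
  have forms: "one_form A (v' i)" "one_form A (w' i)" if "i \<in> {1..n}" for i
    using assms(5) that by (auto simp: dual_coframe_Plus)
  have lin: "linear_form_on (tangent_space A p) (v' i p)" "linear_form_on (tangent_space A p) (w' i p)"
    if "i \<in> {1..n}" for i p
    using forms[OF that] unfolding one_form_def by blast+
  have vw: "v' i p (v j p) = (if i = j then 1 else 0)" "v' i p (w j p) = 0"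
    "w' i p (w j p) = (if i = j then 1 else 0)" "w' i p (v j p) = 0"
    if "i \<in> {1..n}" "j \<in> {1..n}" for i j p
    using assms(5) that by (auto simp: dual_coframe_Plus)
  have basis: "tbasis (tangent_space A p) ({1..n} <+> {1..n}) (\<lambda>i. case_sum v w i p)" for p
    using assms(4) unfolding global_frame_def by blast
  have T: "v i p \<in> tangent_space A p" "w i p \<in> tangent_space A p" if "i \<in> {1..n}" for i p
    using basis[of p] that unfolding tbasis_def by force+
  have linJ: "linear_form_on (tangent_space A p) (\<lambda>D. \<omega> (J p D))"
    if "linear_form_on (tangent_space A p) \<omega>" for \<omega> p
    using assms(6) that unfolding almost_complex_structure_def linear_form_on_def by simp
  have neg: "linear_form_on (tangent_space A p) (\<lambda>D. - \<omega> D)"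
    if "linear_form_on (tangent_space A p) \<omega>" for \<omega> p
    using that unfolding linear_form_on_def by simp
  \<comment> \<open>Both sides are linear in \<open>D\<close>, so it suffices to test them on the
    frame, where \<open>J\<close> exchanges the two families up to sign.\<close>
  have v'J: "v' i p (J p D) = - w' i p D" and w'J: "w' i p (J p D) = v' i p D"
    if i: "i \<in> {1..n}" and D: "D \<in> tangent_space A p" for i p D
  proof -
    show "v' i p (J p D) = - w' i p D"
      by (rule linear_form_on_eqI_basis[OF basis linJ[OF lin(1)[OF i]] neg[OF lin(2)[OF i]] _ D])
         (use i in \<open>auto simp: assms(7,8) vw T linear_form_on_uminus[OF lin(1)[OF i]]\<close>)
    show "w' i p (J p D) = v' i p D"
      by (rule linear_form_on_eqI_basis[OF basis linJ[OF lin(2)[OF i]] lin(1)[OF i] _ D])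
         (use i in \<open>auto simp: assms(7,8) vw T linear_form_on_uminus[OF lin(2)[OF i]]\<close>)
  qed
  \<comment> \<open>Both sides become the sum over i of w'(D) v'(E) + v'(D) w'(E). The minus sign on
    the v-block of \<open>g\<close> makes \<open>J\<close> self-adjoint rather than skew.\<close>
  have "g p (J p D) E = g p D (J p E)" if "D \<in> tangent_space A p" "E \<in> tangent_space A p" for p D E
    using that by (simp add: assms(9) v'J w'J sum_negf)
  then show ?thesis
    using quasi_statistical_conn_plus[OF assms(1) metric assms(10,6)] forms by blast
qed

end
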